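(* Let $R$ be a commutative ring with identity and let $S\subseteq R$ be a multiplicative set with $0\notin S$. If $R$ is $S$-reduced, then the intersection $\bigcap_{P\in \mathrm{Spec}_S(R)}P$ of all $S$-prime ideals of $R$ is an $S$-zero ideal; that is, for every $x\in\bigcap_{P\in \mathrm{Spec}_S(R)}P$ there exists $s\in S$ such that $sx=0$.
   Context: A multiplicative set $S\subseteq R$ is a subset containing $1$ and closed under multiplication. $R$ is $S$-reduced if for every $r\in R$ with $r^n=0$ for some $n\in\mathbb{N}$, there exists $s\in S$ (possibly depending on $r$) with $sr=0$. An ideal $P$ of $R$ with $P\cap S=\emptyset$ is $S$-prime if there exists $s\in S$ such that for all $a,b\in R$ with $ab\in P$, we have $sa\in P$ or $sb\in P$. $\mathrm{Spec}_S(R)$ denotes the set of all $S$-prime ideals of $R$. An ideal $I$ is $S$-zero if for each $a\in I$ there exists $s\in S$ with $sa=0$. *)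

theory Defs
  imports "HOL-Algebra.Ideal"
begin

text \<open>
  A multiplicative set of a ring \<open>R\<close> is rendered by the library predicate \<open>submonoid S R\<close>:
  \<open>S \<subseteq> carrier R\<close>, \<open>\<one> \<in> S\<close>, and \<open>S\<close> is closed under \<open>\<otimes>\<close>.
\<close>

text \<open>The exponent may be \<open>0\<close>: \<open>r [^] 0 = \<zero>\<close> forces \<open>R\<close> to be the zero ring, so this adds nothing.\<close>

definition S_reduced :: "('a, 'b) ring_scheme \<Rightarrow> 'a set \<Rightarrow> bool" where
  "S_reduced R S \<longleftrightarrow>
     (\<forall>r \<in> carrier R. (\<exists>n::nat. r [^]\<^bsub>R\<^esub> n = \<zero>\<^bsub>R\<^esub>) \<longrightarrow> (\<exists>s \<in> S. s \<otimes>\<^bsub>R\<^esub> r = \<zero>\<^bsub>R\<^esub>))"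

definition S_prime_ideal :: "('a, 'b) ring_scheme \<Rightarrow> 'a set \<Rightarrow> 'a set \<Rightarrow> bool" where
  "S_prime_ideal R S P \<longleftrightarrow>
     ideal P R \<and> P \<inter> S = {} \<and>
     (\<exists>s \<in> S. \<forall>a \<in> carrier R. \<forall>b \<in> carrier R.
        a \<otimes>\<^bsub>R\<^esub> b \<in> P \<longrightarrow> s \<otimes>\<^bsub>R\<^esub> a \<in> P \<or> s \<otimes>\<^bsub>R\<^esub> b \<in> P)"

definition S_Spec :: "('a, 'b) ring_scheme \<Rightarrow> 'a set \<Rightarrow> 'a set set" where
  "S_Spec R S = {P. S_prime_ideal R S P}"

definition S_zero_ideal :: "('a, 'b) ring_scheme \<Rightarrow> 'a set \<Rightarrow> 'a set \<Rightarrow> bool" where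
  "S_zero_ideal R S I \<longleftrightarrow> ideal I R \<and> (\<forall>a \<in> I. \<exists>s \<in> S. s \<otimes>\<^bsub>R\<^esub> a = \<zero>\<^bsub>R\<^esub>)"

end

theory Submission
  imports Defs "HOL-Algebra.Ring_Divisibility"
begin

text \<open>
  A prime ideal disjoint from \<open>S\<close> is \<open>S\<close>-prime with witness \<open>\<one>\<close>. If \<open>x\<close> lies in every \<open>S\<close>-prime
  ideal, then no prime ideal avoids the multiplicative set of all \<open>s \<otimes> x [^] n\<close>, so by Krull's
  lemma this set contains \<open>\<zero>\<close>. Then \<open>s \<otimes> x\<close> is nilpotent and \<open>S\<close>-reducedness kills it.
\<close>

text \<open>By maximality, adjoining to \<open>P\<close> an element outside it yields an ideal
  meeting \<open>T\<close>. If \<open>a\<close> and \<open>b\<close> both lay outside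
  \<open>P\<close>, the two elements of \<open>T\<close> so obtained would have a product in
  \<open>T\<close>, and also in \<open>P\<close> because
  \<open>a \<otimes> b \<in> P\<close>.\<close>

lemma (in cring) maximal_disjoint_ideal_is_prime:
  assumes T: "submonoid T R" and P: "ideal P R" and disj: "P \<inter> T = {}"
    and max: "\<And>J. \<lbrakk>ideal J R; P \<subseteq> J; J \<inter> T = {}\<rbrakk> \<Longrightarrow> J = P"
  shows "primeideal P R"
proof (rule primeidealI[OF P is_cring])
  interpret T: submonoid T R by (rule T)
  interpret P: ideal P R by (rule P)
  show "carrier R \<noteq> P"
    using disj T.one_closed one_closed by blast
  have meets: "\<exists>p \<in> P. \<exists>r \<in> carrier R. p \<oplus> r \<otimes> a \<in> T"
    if a: "a \<in> carrier R" "a \<notin> P" for a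
  proof -
    let ?J = "P <+>\<^bsub>R\<^esub> PIdl a"
    have J: "ideal ?J R"
      by (intro add_ideals P cgenideal_ideal a)
    interpret A: ideal "PIdl a" R
      by (intro cgenideal_ideal a)
    have J_I: "p \<oplus> c \<in> ?J" if "p \<in> P" "c \<in> PIdl a" for p c
      unfolding set_add_def' using that by blast
    have "p \<in> ?J" if "p \<in> P" for p
      using J_I[OF that A.zero_closed] P.Icarr[OF that] by simp
    then have sub: "P \<subseteq> ?J" by blast
    have "a \<in> ?J"
      using J_I[OF P.zero_closed cgenideal_self[OF a(1)]] a(1) by simp
    with a(2) max[OF J sub] have "?J \<inter> T \<noteq> {}" by blast
    then show ?thesis
      unfolding set_add_def' cgenideal_def by blast
  qed
  fix a b assume a: "a \<in> carrier R" and b: "b \<in> carrier R" and ab: "a \<otimes> b \<in> P"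
  show "a \<in> P \<or> b \<in> P"
  proof (rule ccontr)
    assume "\<not> ?thesis"
    then obtain p r q t where p: "p \<in> P" and r: "r \<in> carrier R" and pr: "p \<oplus> r \<otimes> a \<in> T"
      and q: "q \<in> P" and t: "t \<in> carrier R" and qt: "q \<oplus> t \<otimes> b \<in> T"
      using meets[OF a] meets[OF b] by blast
    have [simp]: "p \<in> carrier R" "q \<in> carrier R" using p q by (auto intro: P.Icarr)
    \<comment> \<open>The expansion is grouped so that each summand carries a factor from
      \<open>P\<close>: \<open>p\<close>, \<open>q\<close> or \<open>a \<otimes> b\<close>.\<close>
    have "(p \<oplus> r \<otimes> a) \<otimes> (q \<oplus> t \<otimes> b)
        = p \<otimes> (q \<oplus> t \<otimes> b) \<oplus> ((r \<otimes> a) \<otimes> q \<oplus> (r \<otimes> t) \<otimes> (a \<otimes> b))"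
      using a b r t by (simp add: l_distr r_distr m_ac a_ac)
    also have "\<dots> \<in> P"
      using a b r t p q ab by (simp add: P.a_closed P.I_l_closed P.I_r_closed)
    finally show False
      using T.m_closed[OF pr qt] disj by blast
  qed
qed

text \<open>Krull's lemma, by Zorn on the ideals avoiding \<open>T\<close>: the zero ideal is one of
  them since \<open>\<zero> \<notin> T\<close>, and the union of a nonempty chain of them is again
  one. A maximal element is prime.\<close>

lemma (in cring) ex_primeideal_disjoint:
  assumes T: "submonoid T R" and zero: "\<zero> \<notin> T"
  shows "\<exists>P. primeideal P R \<and> P \<inter> T = {}"
proof -
  let ?A = "{I. ideal I R \<and> I \<inter> T = {}}"
  have "\<exists>M\<in>?A. \<forall>X\<in>?A. M \<subseteq> X \<longrightarrow> X = M"
  proof (rule subset_Zorn_nonempty)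
    show "?A \<noteq> {}"
      using zeroideal zero by blast
  next
    fix C assume "C \<noteq> {}" and C: "subset.chain ?A C"
    moreover from C have "subset.chain {I. ideal I R} C"
      unfolding pred_on.chain_def by blast
    ultimately have "ideal (\<Union>C) R"
      using chain_Union_is_ideal[of C] by simp
    with C show "\<Union>C \<in> ?A"
      unfolding pred_on.chain_def by blast
  qed
  then obtain M where M: "M \<in> ?A" and max: "\<forall>X\<in>?A. M \<subseteq> X \<longrightarrow> X = M" ..
  have "primeideal M R"
    using M max by (intro maximal_disjoint_ideal_is_prime[OF T]) simp_all
  with M show ?thesis by blast
qed

text \<open>This is the smallest submonoid containing \<open>S\<close> and \<open>x\<close>;
  commutativity lets the powers of \<open>x\<close> be collected.\<close>

lemma (in cring) submonoid_adjoin_powers: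
  assumes S: "submonoid S R" and x: "x \<in> carrier R"
  shows "submonoid {s \<otimes> x [^] n | s (n::nat). s \<in> S} R"
proof -
  interpret S: submonoid S R by (rule S)
  note [simp] = S.subset[THEN subsetD] x
  show ?thesis
  proof
    show "{s \<otimes> x [^] n | s (n::nat). s \<in> S} \<subseteq> carrier R"
      by auto
    show "\<one> \<in> {s \<otimes> x [^] n | s (n::nat). s \<in> S}"
      unfolding mem_Collect_eq by (intro exI[of _ \<one>] exI[of _ "0::nat"]) simp
  next
    fix u v
    assume "u \<in> {s \<otimes> x [^] n | s (n::nat). s \<in> S}"
      and "v \<in> {s \<otimes> x [^] n | s (n::nat). s \<in> S}"
    then obtain s t and m n :: nat where s: "s \<in> S" and t: "t \<in> S"
      and u: "u = s \<otimes> x [^] m" and v: "v = t \<otimes> x [^] n" by blast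
    have "u \<otimes> v = (s \<otimes> t) \<otimes> x [^] (m + n)"
      using s t by (simp add: u v nat_pow_mult[symmetric] m_ac)
    with s t show "u \<otimes> v \<in> {s \<otimes> x [^] n | s (n::nat). s \<in> S}"
      by blast
  qed
qed

lemma (in cring) S_prime_ideal_if_primeideal:
  assumes S: "submonoid S R" and P: "primeideal P R" and disj: "P \<inter> S = {}"
  shows "S_prime_ideal R S P"
proof -
  interpret P: primeideal P R by (rule P)
  have "\<one> \<in> S"
    using S by (rule submonoid.one_closed)
  then show ?thesis
    unfolding S_prime_ideal_def using P.is_ideal disj P.I_prime
    by (intro conjI bexI[of _ \<one>]) simp_all
qed

theorem theorem2p16:
  fixes R :: "('a, 'b) ring_scheme" and S :: "'a set"
  assumes "cring R"
    and "submonoid S R"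
    and "\<zero>\<^bsub>R\<^esub> \<notin> S"
    and "S_reduced R S"
  shows "S_zero_ideal R S (\<Inter>P \<in> S_Spec R S. P)"
proof -
  interpret cring R by fact
  interpret S: submonoid S R by fact
  \<comment> \<open>The spectrum must be nonempty: the intersection of the empty family would be the
    whole type, not an ideal inside the carrier. This is where \<open>\<zero> \<notin> S\<close>
    enters.\<close>
  obtain P\<^sub>0 where P\<^sub>0: "P\<^sub>0 \<in> S_Spec R S"
    using ex_primeideal_disjoint[OF assms(2,3)] S_prime_ideal_if_primeideal[OF assms(2)]
    unfolding S_Spec_def by blast
  have ideals: "ideal P R" if "P \<in> S_Spec R S" for P
    using that unfolding S_Spec_def S_prime_ideal_def by blast
  have "ideal (\<Inter>(S_Spec R S)) R"
    using P\<^sub>0 ideals by (intro i_Intersect) auto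
  moreover have "\<exists>s\<in>S. s \<otimes>\<^bsub>R\<^esub> x = \<zero>\<^bsub>R\<^esub>" if x: "x \<in> \<Inter>(S_Spec R S)" for x
  proof -
    have xR: "x \<in> carrier R"
      using x P\<^sub>0 ideal.Icarr[OF ideals] by blast
    let ?T = "{s \<otimes>\<^bsub>R\<^esub> x [^]\<^bsub>R\<^esub> n | s (n::nat). s \<in> S}"
    \<comment> \<open>Exponent 0 puts \<open>S\<close> into \<open>?T\<close>, so a prime avoiding
      \<open>?T\<close> is \<open>S\<close>-prime and hence contains \<open>x\<close>; but
      \<open>x\<close> is itself in \<open>?T\<close>.\<close>
    have S_T: "s \<in> ?T" if "s \<in> S" for s
      unfolding mem_Collect_eq using that S.subset
      by (intro exI[of _ s] exI[of _ "0::nat"]) (simp add: subset_iff)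
    have x_T: "x \<in> ?T"
      unfolding mem_Collect_eq using xR
      by (intro exI[of _ "\<one>\<^bsub>R\<^esub>"] exI[of _ "1::nat"]) simp
    have "\<zero>\<^bsub>R\<^esub> \<in> ?T"
    proof (rule ccontr)
      assume "\<zero>\<^bsub>R\<^esub> \<notin> ?T"
      then obtain P where P: "primeideal P R" "P \<inter> ?T = {}"
        using ex_primeideal_disjoint[OF submonoid_adjoin_powers[OF assms(2) xR]] by blast
      have "P \<inter> S = {}" using P(2) S_T by blast
      then have "P \<in> S_Spec R S"
        using S_prime_ideal_if_primeideal[OF assms(2) P(1)] unfolding S_Spec_def by blast
      with x P(2) x_T show False by blast
    qed
    then obtain s and n :: nat where s: "s \<in> S" and sx: "s \<otimes>\<^bsub>R\<^esub> x [^]\<^bsub>R\<^esub> n = \<zero>\<^bsub>R\<^esub>"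
      unfolding mem_Collect_eq by metis
    have sR: "s \<in> carrier R" using s S.subset by blast
    \<comment> \<open>The exponent \<open>Suc n\<close> leaves a factor \<open>s\<close> to pair
      with \<open>x [^] n\<close> even when \<open>n = 0\<close>.\<close>
    have "(s \<otimes>\<^bsub>R\<^esub> x) [^]\<^bsub>R\<^esub> Suc n
        = (s [^]\<^bsub>R\<^esub> n \<otimes>\<^bsub>R\<^esub> x) \<otimes>\<^bsub>R\<^esub> (s \<otimes>\<^bsub>R\<^esub> x [^]\<^bsub>R\<^esub> n)"
      using sR xR by (simp add: nat_pow_distrib m_ac)
    also have "\<dots> = \<zero>\<^bsub>R\<^esub>"
      using sR xR by (simp add: sx)
    finally obtain t where t: "t \<in> S" "t \<otimes>\<^bsub>R\<^esub> (s \<otimes>\<^bsub>R\<^esub> x) = \<zero>\<^bsub>R\<^esub>"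
      using assms(4) sR xR unfolding S_reduced_def by blast
    \<comment> \<open>Since \<open>t\<close> kills \<open>s \<otimes> x\<close> rather than
      \<open>x\<close>, the witness for \<open>x\<close> is the product
      \<open>t \<otimes> s\<close>, again in \<open>S\<close>.\<close>
    then have "(t \<otimes>\<^bsub>R\<^esub> s) \<otimes>\<^bsub>R\<^esub> x = \<zero>\<^bsub>R\<^esub>"
      using S.subset sR xR by (simp add: m_assoc subset_iff)
    with t(1) s show ?thesis by blast
  qed
  ultimately show ?thesis
    unfolding S_zero_ideal_def by simp
qed

end
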